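(* Let $\mathcal{K}$ be the symmetric cone (cone of squares) of a Euclidean Jordan algebra $\mathcal{E}$ and let $\mathcal{F}$ be an arbitrary face of $\mathcal{K}$. Let $z\in\mathcal{F}^*$ and $\hat{\mathcal{F}}=\mathcal{F}\cap\{z\}^\perp$. Then there is a positive constant $\kappa$ (depending on $\mathcal{K},\mathcal{F},z$) such that whenever $x\in\mathcal{E}$ and $\epsilon$ satisfy $$\operatorname{dist}(x,\mathcal{K})\le\epsilon,\quad \langle x,z\rangle\le\epsilon,\quad \operatorname{dist}(x,\operatorname{span}\mathcal{F})\le\epsilon,$$ we have $$\operatorname{dist}(x,\hat{\mathcal{F}})\le\kappa\epsilon+\kappa\sqrt{\epsilon\|x\|}.$$ That is, $\psi_{\mathcal{F},z}(\epsilon,\|x\|)=\kappa\epsilon+\kappa\sqrt{\epsilon\|x\|}$ is a facial residual function for $\mathcal{F}$ and $z$.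
   Context: A Euclidean Jordan algebra is a finite-dimensional real vector space $\mathcal{E}$ with a bilinear product $\circ$ (with identity element $e$) and an inner product such that $x\circ y=y\circ x$, $x\circ(x^2\circ y)=x^2\circ(x\circ y)$ with $x^2=x\circ x$, and $\langle x\circ y,z\rangle=\langle x,y\circ z\rangle$. Its cone of squares is $\mathcal{K}=\{x^2: x\in\mathcal{E}\}$, a symmetric cone. By the spectral theorem every $x$ is $\sum_{i=1}^r\lambda_ic_i$ with $c_i$ primitive idempotents, $c_i\circ c_j=0$ for $i\ne j$, $\sum c_i=e$, and unique real eigenvalues $\lambda_i$; $\operatorname{tr}x=\sum_i\lambda_i$. Throughout, the inner product is $\langle x,y\rangle=\operatorname{tr}(x\circ y)$, with induced norm $\|x\|=\sqrt{\operatorname{tr}(x^2)}$, and $\operatorname{dist}(x,C)=\inf\{\|x-y\|:y\in C\}$. A face of $\mathcal{K}$ is a convex cone $\mathcal{F}\subseteq\mathcal{K}$ such that $x,y\in\mathcal{K}$, $x+y\in\mathcal{F}$ imply $x,y\in\mathcal{F}$. $\mathcal{F}^*=\{x:\langle x,y\rangle\ge0\ \forall y\in\mathcal{F}\}$; $\{z\}^\perp$ is the set of vectors orthogonal to $z$. A function $\psi_{\mathcal{F},z}:\mathbb{R}_+\times\mathbb{R}_+\to\mathbb{R}_+$ is a facial residual function for $\mathcal{F}$ and $z$ (with respect to $\mathcal{K}$) if (1) it is nonnegative, monotone nondecreasing in each argument, and $\psi_{\mathcal{F},z}(0,\alpha)=0$ for all $\alpha\ge0$; (2) whenever $x\in\operatorname{span}\mathcal{K}$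 and $\epsilon\ge 0$ satisfy $\operatorname{dist}(x,\mathcal{K})\le\epsilon$, $\langle x,z\rangle\le\epsilon$, $\operatorname{dist}(x,\operatorname{span}\mathcal{F})\le\epsilon$, we have $\operatorname{dist}(x,\mathcal{F}\cap\{z\}^\perp)\le\psi_{\mathcal{F},z}(\epsilon,\|x\|)$. *)

theory Defs
  imports "HOL-Analysis.Analysis"
begin

text \<open>The inner product of the algebra is that of the type class; the class
  \<^class>\<open>euclidean_space\<close> also provides finite dimension, and the
  norm and \<^const>\<open>infdist\<close> are the induced ones.\<close>

locale euclidean_jordan_algebra =
  fixes jp :: "'a::euclidean_space \<Rightarrow> 'a \<Rightarrow> 'a"
    and e :: 'a
  assumes bilinear: "bilinear jp"
    and commutative: "jp x y = jp y x"
    and jordan_identity: "jp x (jp (jp x x) y) = jp (jp x x) (jp x y)"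
    and identity: "jp e x = x"
    and inner_associative: "jp x y \<bullet> z = x \<bullet> jp y z"

definition cone_of_squares :: "('a \<Rightarrow> 'a \<Rightarrow> 'a) \<Rightarrow> 'a set" where
  "cone_of_squares jp = {jp x x | x. True}"

definition idempotent :: "('a \<Rightarrow> 'a \<Rightarrow> 'a) \<Rightarrow> 'a \<Rightarrow> bool" where
  "idempotent jp c \<longleftrightarrow> jp c c = c"

definition primitive_idempotent :: "('a::real_vector \<Rightarrow> 'a \<Rightarrow> 'a) \<Rightarrow> 'a \<Rightarrow> bool" where
  "primitive_idempotent jp c \<longleftrightarrow>
     idempotent jp c \<and> c \<noteq> 0 \<and>
     \<not> (\<exists>a b. idempotent jp a \<and> idempotent jp b \<and> a \<noteq> 0 \<and> b \<noteq> 0 \<and> jp a b = 0 \<and> c = a + b)"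

definition jordan_frame ::
    "('a::real_vector \<Rightarrow> 'a \<Rightarrow> 'a) \<Rightarrow> 'a \<Rightarrow> nat \<Rightarrow> (nat \<Rightarrow> 'a) \<Rightarrow> bool" where
  "jordan_frame jp e r c \<longleftrightarrow>
     (\<forall>i<r. primitive_idempotent jp (c i)) \<and>
     (\<forall>i<r. \<forall>j<r. i \<noteq> j \<longrightarrow> jp (c i) (c j) = 0) \<and>
     (\<Sum>i<r. c i) = e"

text \<open>The sum of the eigenvalues (with multiplicity) in a spectral decomposition. In a
  Euclidean Jordan algebra every element has one, and all of them give the same sum.\<close>

definition jordan_trace :: "('a::real_vector \<Rightarrow> 'a \<Rightarrow> 'a) \<Rightarrow> 'a \<Rightarrow> 'a \<Rightarrow> real" where
  "jordan_trace jp e x =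
     (THE t. \<exists>r c l. jordan_frame jp e r c \<and> x = (\<Sum>i<r. l i *\<^sub>R c i) \<and> t = (\<Sum>i<r. l i))"

text \<open>This is the notion of face for convex cones, phrased with sums instead of the open
  segments of \<^const>\<open>face_of\<close>; \<^const>\<open>convex_cone\<close> includes nonemptiness.\<close>

definition cone_face :: "'a::real_vector set \<Rightarrow> 'a set \<Rightarrow> bool" where
  "cone_face F K \<longleftrightarrow>
     convex_cone F \<and> F \<subseteq> K \<and> (\<forall>x\<in>K. \<forall>y\<in>K. x + y \<in> F \<longrightarrow> x \<in> F \<and> y \<in> F)"

definition dual_cone :: "'a::real_inner set \<Rightarrow> 'a set" where
  "dual_cone F = {x. \<forall>y\<in>F. 0 \<le> x \<bullet> y}"

text \<open>Only the values of \<open>\<psi>\<close> at nonnegative arguments matter.\<close>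

definition facial_residual_function ::
    "'a::euclidean_space set \<Rightarrow> 'a set \<Rightarrow> 'a \<Rightarrow> (real \<Rightarrow> real \<Rightarrow> real) \<Rightarrow> bool" where
  "facial_residual_function K F z \<psi> \<longleftrightarrow>
     (\<forall>a\<ge>0. \<forall>b\<ge>0. 0 \<le> \<psi> a b) \<and>
     (\<forall>a a' b. 0 \<le> a \<and> a \<le> a' \<and> 0 \<le> b \<longrightarrow> \<psi> a b \<le> \<psi> a' b) \<and>
     (\<forall>a b b'. 0 \<le> a \<and> 0 \<le> b \<and> b \<le> b' \<longrightarrow> \<psi> a b \<le> \<psi> a b') \<and>
     (\<forall>b\<ge>0. \<psi> 0 b = 0) \<and>
     (\<forall>x\<in>span K. \<forall>\<epsilon>\<ge>0.
        infdist x K \<le> \<epsilon> \<and> x \<bullet> z \<le> \<epsilon> \<and> infdist x (span F) \<le> \<epsilon> \<longrightarrow>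
        infdist x (F \<inter> {z}\<^sup>\<bottom>) \<le> \<psi> \<epsilon> (norm x))"

end

theory Submission
  imports Defs
begin

text \<open>A face \<open>F\<close> of the cone \<open>K\<close> of squares contains an idempotent \<open>c\<close> with
  \<open>F = K \<inter> V(c)\<close>, where \<open>V(c) = {a. c \<circ> a = a}\<close>. Applied to the
  face \<open>F \<inter> {z}\<^sup>\<bottom>\<close>, this gives an idempotent \<open>g\<close>, obtained from \<open>c\<close> by removing
  the support of the projection of \<open>z\<close> to \<open>V(c)\<close>. If \<open>y = u\<^sup>2\<close> is a point of \<open>K\<close> near \<open>x\<close>,
  then the assumptions on \<open>x\<close> bound \<open>\<langle>y, e - g\<rangle>\<close> by a multiple of \<open>\<epsilon>\<close>. Since
  \<open>\<langle>u\<^sup>2, e - g\<rangle> = \<langle>u, (1 - L(g)) u\<rangle>\<close> and the nonzero eigenvalues of \<open>1 - L(g)\<close> are \<open>1/2\<close> and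
  \<open>1\<close>, the projection \<open>u\<^sub>1\<close> of \<open>u\<close> to \<open>V(g)\<close> is at distance \<open>O(\<surd>\<epsilon>)\<close> from \<open>u\<close>, so the point
  \<open>u\<^sub>1\<^sup>2\<close> of \<open>F \<inter> {z}\<^sup>\<bottom>\<close> is at distance \<open>O(\<surd>\<epsilon> |u|)\<close> from \<open>y\<close>, and \<open>|u|\<^sup>2 = \<langle>y, e\<rangle>\<close>.\<close>

section \<open>Distances and eigenvectors of symmetric operators\<close>

lemma infdist_less_obtain:
  assumes "infdist x A < r" "A \<noteq> {}"
  obtains y where "y \<in> A" "dist x y < r"
proof -
  have "\<not> (\<forall>y\<in>A. r \<le> dist x y)"
    using assms cINF_greatest[of A r "dist x"] by (auto simp: infdist_notempty)
  then show ?thesis using that by (auto simp: not_le)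
qed

text \<open>A maximiser \<open>v\<close> of \<open>T v \<bullet> v\<close> on the unit sphere of
  \<open>A\<close> is an eigenvector: otherwise moving \<open>v\<close> along the residual
  \<open>h = T v - l *\<^sub>R v\<close>, which lies in \<open>A\<close>, would increase the
  Rayleigh quotient to first order.\<close>

lemma symmetric_operator_eigenvector:
  fixes T :: "'a::euclidean_space \<Rightarrow> 'a"
  assumes T: "linear T" and A: "subspace A" "A \<noteq> {0}" "T ` A \<subseteq> A"
    and sym: "\<And>x y. T x \<bullet> y = x \<bullet> T y"
  obtains v l where "v \<in> A" "v \<noteq> 0" "T v = l *\<^sub>R v"
proof -
  define S where "S = A \<inter> sphere 0 1"
  obtain a where a: "a \<in> A" "a \<noteq> 0"
    using A subspace_0 by blast
  have "a /\<^sub>R norm a \<in> S"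
    using a A by (simp add: S_def subspace_scale)
  moreover have "compact S"
    unfolding S_def using closed_subspace[OF A(1)] by (simp add: closed_Int_compact)
  moreover have "continuous_on S (\<lambda>v. T v \<bullet> v)"
    by (intro continuous_intros linear_continuous_on)
       (use T in \<open>simp add: linear_conv_bounded_linear\<close>)
  ultimately obtain v where v: "v \<in> S" and max: "\<And>u. u \<in> S \<Longrightarrow> T u \<bullet> u \<le> T v \<bullet> v"
    using continuous_attains_sup[of S "\<lambda>v. T v \<bullet> v"] by blast
  define l where "l = T v \<bullet> v"
  interpret T: linear T by fact
  have vA: "v \<in> A" and nv: "v \<bullet> v = 1"
    using v by (auto simp: S_def dot_square_norm)
  have form: "T u \<bullet> u \<le> l * (u \<bullet> u)" if u: "u \<in> A" for u
  proof (cases "u = 0")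
    case False
    have "u /\<^sub>R norm u \<in> S"
      using u False A by (simp add: S_def subspace_scale)
    from max[OF this] have "(T u \<bullet> u) / (norm u * norm u) \<le> l"
      by (simp add: T.scale l_def divide_simps)
    then show ?thesis
      using False by (simp add: divide_simps dot_square_norm power2_eq_square)
  qed (simp add: T.zero)
  define h where "h = T v - l *\<^sub>R v"
  have hA: "h \<in> A"
    using vA A by (auto simp: h_def intro!: subspace_diff subspace_scale)
  \<comment> \<open>This is \<open>form\<close> at \<open>v + t *\<^sub>R h\<close>; the terms of
    order 0 cancel.\<close>
  have quad: "2 * t * (h \<bullet> h) \<le> t\<^sup>2 * (l * (h \<bullet> h) - T h \<bullet> h)" for t
  proof -
    have "T (v + t *\<^sub>R h) \<bullet> (v + t *\<^sub>R h) \<le> l * ((v + t *\<^sub>R h) \<bullet> (v + t *\<^sub>R h))"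
      using form vA hA A by (simp add: subspace_add subspace_scale)
    moreover have Tv: "T v \<bullet> h = h \<bullet> h + l * (v \<bullet> h)"
      using inner_add_left[of h "l *\<^sub>R v" h] by (simp add: h_def)
    moreover have "T h \<bullet> v = h \<bullet> h + l * (v \<bullet> h)"
      using sym[of h v] Tv by (simp add: inner_commute)
    ultimately show ?thesis
      using nv by (simp add: T.add T.scale inner_add_left inner_add_right l_def[symmetric]
          inner_commute[of h v] algebra_simps power2_eq_square)
  qed
  have "h \<bullet> h \<le> 0"
  proof (rule ccontr)
    assume pos: "\<not> h \<bullet> h \<le> 0"
    \<comment> \<open>A positive upper bound of the coefficient of \<open>t\<^sup>2\<close>, so that
      \<open>t = h \<bullet> h / q\<close> contradicts \<open>quad\<close>.\<close>
    define q where "q = \<bar>l * (h \<bullet> h) - T h \<bullet> h\<bar> + 1"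
    have q: "q > 0" "l * (h \<bullet> h) - T h \<bullet> h \<le> q" by (auto simp: q_def)
    have "2 * (h \<bullet> h / q) * (h \<bullet> h) \<le> (h \<bullet> h / q)\<^sup>2 * q"
      using quad[of "h \<bullet> h / q"] mult_left_mono[OF q(2), of "(h \<bullet> h / q)\<^sup>2"] by simp
    also have "\<dots> = (h \<bullet> h / q) * (h \<bullet> h)" using q by (simp add: power2_eq_square)
    finally show False using q pos by (simp add: divide_simps mult_le_0_iff)
  qed
  then have "h = 0" by (metis inner_eq_zero_iff inner_ge_zero order_antisym)
  then show ?thesis
    using that[of v l] vA nv by (force simp: h_def)
qed

section \<open>The Jordan identity and powers of one element\<close>

context euclidean_jordan_algebra
begin

sublocale jp: bounded_bilinear jp
  using bilinear by (simp add: bilinear_conv_bounded_bilinear)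

lemma inner_jp_commute: "jp a x \<bullet> y = x \<bullet> jp a y"
  using inner_associative[of x a y] by (simp add: commutative[of x a])

lemma identity_right: "jp x e = x"
  using identity commutative by metis

text \<open>The identity \<open>L(x\<^sup>2y) = L(x\<^sup>2)L(y) - 2L(x)L(y)L(x) + 2L(xy)L(x)\<close> between multiplication
  operators: the part of the Jordan identity for \<open>x + z\<close> that is linear in \<open>z\<close>.\<close>

lemma linearised_jordan_identity:
  "jp (jp (jp x x) y) z =
     jp (jp x x) (jp y z) - 2 *\<^sub>R jp x (jp y (jp x z)) + 2 *\<^sub>R jp (jp x y) (jp x z)"
proof -
  \<comment> \<open>The identity at \<open>x + z\<close> minus that at \<open>x - z\<close> is twice
    its part odd in \<open>z\<close>. The cubic part is the identity at \<open>z\<close>, which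
    leaves the linear part \<open>D\<close>.\<close>
  have plus: "jp (x + z) (jp (jp (x + z) (x + z)) y) - jp (jp (x + z) (x + z)) (jp (x + z) y) = 0"
    and minus: "jp (x - z) (jp (jp (x - z) (x - z)) y) - jp (jp (x - z) (x - z)) (jp (x - z) y) = 0"
    and cube: "jp z (jp (jp z z) y) - jp (jp z z) (jp z y) = 0"
    using jordan_identity by simp_all
  define D where "D = jp z (jp (jp x x) y) - jp (jp x x) (jp z y)
     + 2 *\<^sub>R jp x (jp (jp x z) y) - 2 *\<^sub>R jp (jp x z) (jp x y)"
  have "2 *\<^sub>R D = (jp (x + z) (jp (jp (x + z) (x + z)) y) - jp (jp (x + z) (x + z)) (jp (x + z) y))
     - (jp (x - z) (jp (jp (x - z) (x - z)) y) - jp (jp (x - z) (x - z)) (jp (x - z) y))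
     - 2 *\<^sub>R (jp z (jp (jp z z) y) - jp (jp z z) (jp z y))"
    by (simp add: D_def jp.add_left jp.add_right jp.diff_left jp.diff_right commutative[of z x]
        scaleR_2 algebra_simps)
  then have "D = 0" by (simp only: plus minus cube) simp
  then show ?thesis
    by (simp add: D_def commutative[of z "jp (jp x x) y"] commutative[of z y]
        commutative[of "jp x z" y] commutative[of "jp x z" "jp x y"] algebra_simps)
qed

text \<open>Here and below \<open>(jp x ^^ n) x\<close> is the power of \<open>x\<close> with
  exponent \<open>n + 1\<close>, hence the shifts in the exponents.\<close>

lemma square_mult_power: "jp (jp x x) ((jp x ^^ n) x) = (jp x ^^ (n + 2)) x"
proof (induction n)
  case 0
  then show ?case by (simp add: commutative)
next
  case (Suc n)
  then show ?case using jordan_identity[of x "(jp x ^^ n) x"] by simp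
qed

text \<open>The linearised identity, with a power of \<open>x\<close> for \<open>y\<close>,
  expresses multiplication by a power through L(x), L(x^2) and multiplication by the two preceding
  powers. Since L(x^2) occurs there, commuting with it is part of the induction.\<close>

lemma power_mult_commute:
  "jp x (jp ((jp x ^^ n) x) a) = jp ((jp x ^^ n) x) (jp x a) \<and>
   jp (jp x x) (jp ((jp x ^^ n) x) a) = jp ((jp x ^^ n) x) (jp (jp x x) a)"
proof (induction n arbitrary: a rule: induct_nat_012)
  case (ge2 n)
  have "jp ((jp x ^^ Suc (Suc n)) x) b = jp (jp x x) (jp ((jp x ^^ n) x) b)
     - 2 *\<^sub>R jp x (jp ((jp x ^^ n) x) (jp x b)) + 2 *\<^sub>R jp ((jp x ^^ Suc n) x) (jp x b)" for b
    using linearised_jordan_identity[of x "(jp x ^^ n) x" b] square_mult_power[of x n] by simp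
  then show ?case
    using ge2 jordan_identity[of x]
    by (simp only: jp.add_right jp.diff_right jp.scaleR_right)
qed (simp_all add: jordan_identity)

lemma power_mult_power: "jp ((jp x ^^ m) x) ((jp x ^^ n) x) = (jp x ^^ (m + n + 1)) x"
proof (induction n)
  case 0
  then show ?case by (simp add: commutative)
next
  case (Suc n)
  then show ?case using power_mult_commute[of x m "(jp x ^^ n) x"] by simp
qed

text \<open>No unit is demanded, so that an ideal of such a subalgebra is again one; the spectral
  induction passes to ideals.\<close>

definition assoc_subalgebra :: "'a set \<Rightarrow> bool" where
  "assoc_subalgebra A \<longleftrightarrow> subspace A \<and> (\<forall>a\<in>A. \<forall>b\<in>A. jp a b \<in> A) \<and>
     (\<forall>a\<in>A. \<forall>b\<in>A. \<forall>c\<in>A. jp (jp a b) c = jp a (jp b c))"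

lemma assoc_subalgebra_span:
  assumes "\<And>a b. a \<in> P \<Longrightarrow> b \<in> P \<Longrightarrow> jp a b \<in> P"
    and "\<And>a b c. a \<in> P \<Longrightarrow> b \<in> P \<Longrightarrow> c \<in> P \<Longrightarrow> jp (jp a b) c = jp a (jp b c)"
  shows "assoc_subalgebra (span P)"
proof -
  have mult1: "jp a b \<in> span P" if "a \<in> P" "b \<in> span P" for a b
    using that(2)
    by (induction rule: span_induct)
       (auto simp: subspace_def jp.zero_right jp.add_right jp.scaleR_right span_base assms(1) that(1)
         intro: span_zero span_add span_scale)
  have mult: "jp a b \<in> span P" if "a \<in> span P" "b \<in> span P" for a b
    using that(1)
    by (induction rule: span_induct)
       (auto simp: subspace_def jp.zero_left jp.add_left jp.scaleR_left mult1 that(2)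
         intro: span_zero span_add span_scale)
  have assoc1: "jp (jp a b) c = jp a (jp b c)" if "a \<in> P" "b \<in> P" "c \<in> span P" for a b c
    using that(3)
    by (induction rule: span_induct)
       (auto simp: subspace_def jp.zero_right jp.add_right jp.scaleR_right assms(2) that(1,2))
  have assoc2: "jp (jp a b) c = jp a (jp b c)" if "a \<in> P" "b \<in> span P" "c \<in> span P" for a b c
    using that(2)
    by (induction rule: span_induct)
       (auto simp: subspace_def jp.zero_right jp.add_right jp.scaleR_right
         jp.zero_left jp.add_left jp.scaleR_left assoc1 that(1,3))
  have "jp (jp a b) c = jp a (jp b c)" if "a \<in> span P" "b \<in> span P" "c \<in> span P" for a b c
    using that(1)
    by (induction rule: span_induct)
       (auto simp: subspace_def jp.zero_left jp.add_left jp.scaleR_left assoc2 that(2,3))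
  with mult show ?thesis by (simp add: assoc_subalgebra_def)
qed

lemma assoc_subalgebra_powers: "assoc_subalgebra (span (range (\<lambda>n. (jp x ^^ n) x)))"
proof (rule assoc_subalgebra_span, goal_cases)
  case (1 a b)
  then obtain i j where "a = (jp x ^^ i) x" "b = (jp x ^^ j) x" by blast
  then show ?case by (simp only: power_mult_power) (rule rangeI)
next
  case (2 a b c)
  then obtain i j k where "a = (jp x ^^ i) x" "b = (jp x ^^ j) x" "c = (jp x ^^ k) x" by blast
  moreover have "i + j + 1 + k + 1 = i + (j + k + 1) + 1" by simp
  ultimately show ?case by (simp only: power_mult_power)
qed

section \<open>Spectral decomposition\<close>

lemma inner_identity: "jp x y \<bullet> e = x \<bullet> y"
  by (simp add: inner_associative identity_right)

lemma square_eq_0D: "jp x x = 0 \<Longrightarrow> x = 0"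
  using inner_identity[of x x] by simp

text \<open>Unlike a \<open>jordan_frame\<close>, such a set can omit the idempotent of eigenvalue 0
  and so stay inside a subalgebra without \<open>e\<close>.\<close>

definition orthogonal_idempotents :: "'a set \<Rightarrow> bool" where
  "orthogonal_idempotents S \<longleftrightarrow> finite S \<and> (\<forall>c\<in>S. jp c c = c \<and> c \<noteq> 0) \<and>
     (\<forall>c\<in>S. \<forall>d\<in>S. c \<noteq> d \<longrightarrow> jp c d = 0)"

text \<open>Split off an eigenvalue \<open>l\<close> of multiplication by \<open>x\<close> on \<open>A\<close>: the eigenspace is an ideal \<open>E\<close>,
  and if \<open>y\<close> is the component of \<open>x\<close> in \<open>E\<close> then \<open>y\<^sup>2 = l y\<close>, so \<open>y / l\<close> is an idempotent
  (or \<open>y = 0\<close>, if \<open>l = 0\<close>).\<close>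

lemma spectral_assoc:
  assumes "assoc_subalgebra A" "x \<in> A"
  shows "\<exists>S l. orthogonal_idempotents S \<and> S \<subseteq> A \<and> (\<forall>c\<in>S. l c \<noteq> 0) \<and> x = (\<Sum>c\<in>S. l c *\<^sub>R c)"
  using assms
proof (induction "dim A" arbitrary: A x rule: less_induct)
  case less
  have sub: "subspace A" and mult: "\<And>a b. a \<in> A \<Longrightarrow> b \<in> A \<Longrightarrow> jp a b \<in> A"
    and assoc: "\<And>a b c. a \<in> A \<Longrightarrow> b \<in> A \<Longrightarrow> c \<in> A \<Longrightarrow> jp (jp a b) c = jp a (jp b c)"
    using less.prems(1) by (auto simp: assoc_subalgebra_def)
  note x = \<open>x \<in> A\<close>
  show ?case
  proof (cases "A = {0}")
    case True
    then show ?thesis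
      using x by (intro exI[of _ "{}"]) (auto simp: orthogonal_idempotents_def)
  next
    case False
    have "linear (jp x)" using bilinear by (simp add: bilinear_def)
    then obtain v l where v: "v \<in> A" "v \<noteq> 0" "jp x v = l *\<^sub>R v"
      using symmetric_operator_eigenvector[of "jp x" A] sub False mult x inner_jp_commute[of x] by blast
    define E where "E = {a \<in> A. jp x a = l *\<^sub>R a}"
    \<comment> \<open>The complement of the ideal \<open>E\<close> in \<open>A\<close>. It is an
      ideal too, because the inner product is associative; hence products of \<open>E\<close> and
      \<open>B\<close> lie in both and vanish.\<close>
    define B where "B = {b \<in> A. \<forall>a\<in>E. a \<bullet> b = 0}"
    have subE: "subspace E"
      using sub by (auto simp: E_def subspace_def jp.zero_right jp.add_right jp.scaleR_right
          scaleR_add_right)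
    have subB: "subspace B"
      using sub by (auto simp: B_def subspace_def inner_add_right)
    have idealE: "jp a b \<in> E" if "a \<in> E" "b \<in> A" for a b
      using that mult assoc[of x a b] x by (auto simp: E_def jp.scaleR_left)
    have idealB: "jp a b \<in> B" if "a \<in> A" "b \<in> B" for a b
      using that mult idealE[of _ a] inner_associative[of _ a b] by (fastforce simp: B_def)
    have EB: "jp a b = 0" if "a \<in> E" "b \<in> B" for a b
    proof -
      have "jp a b \<in> E" "jp a b \<in> B"
        using that idealE idealB by (auto simp: E_def B_def)
      then show ?thesis by (auto simp: B_def)
    qed
    obtain y w where y: "y \<in> span E" and w: "\<And>u. u \<in> span E \<Longrightarrow> orthogonal w u" and xyw: "x = y + w"
      using orthogonal_subspace_decomp_exists[of E x] by blast
    have yE: "y \<in> E" using y subE by (simp add: span_eq_iff[THEN iffD2])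
    have wB: "w \<in> B"
    proof -
      have "w = x - y" using xyw by simp
      then have "w \<in> A" using x yE sub by (auto simp: E_def intro: subspace_diff)
      then show ?thesis using w by (auto simp: B_def orthogonal_def inner_commute span_base)
    qed
    have "dim B < dim A"
    proof (rule dim_psubset)
      have "v \<notin> B" using v by (auto simp: B_def E_def)
      then show "span B \<subset> span A"
        using v sub subB by (auto simp: span_eq_iff[THEN iffD2] B_def)
    qed
    moreover have "assoc_subalgebra B"
      using subB idealB assoc by (auto simp: assoc_subalgebra_def B_def)
    ultimately obtain S m where S: "orthogonal_idempotents S" "S \<subseteq> B" "\<forall>c\<in>S. m c \<noteq> 0"
      and wS: "w = (\<Sum>c\<in>S. m c *\<^sub>R c)"
      using less.hyps wB by blast
    have yy: "jp y y = l *\<^sub>R y"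
    proof -
      have "jp x y = l *\<^sub>R y" using yE by (simp add: E_def)
      moreover have "jp w y = 0" using EB[OF yE wB] by (simp add: commutative)
      ultimately show ?thesis by (simp add: xyw jp.add_left)
    qed
    show ?thesis
    proof (cases "y = 0")
      case True
      then show ?thesis using S wS xyw by (auto simp: B_def)
    next
      case False
      then have l: "l \<noteq> 0" using yy by (metis scaleR_zero_left square_eq_0D)
      define p where "p = y /\<^sub>R l"
      have p: "p \<in> E" "p \<noteq> 0" "jp p p = p"
        using subE yE False l yy
        by (auto simp: p_def subspace_scale jp.scaleR_left jp.scaleR_right)
      have pS: "jp p c = 0" "jp c p = 0" if "c \<in> S" for c
        using EB[OF p(1), of c] S(2) that by (auto simp: commutative[of c p])
      have "p \<notin> S"
        using pS p by auto
      then have "orthogonal_idempotents (insert p S)" "x = (\<Sum>c\<in>insert p S. (m(p := l)) c *\<^sub>R c)"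
        using S(1) p pS l xyw wS
        by (auto simp: orthogonal_idempotents_def p_def intro!: sum.cong)
      moreover have "insert p S \<subseteq> A" "\<forall>c\<in>insert p S. (m(p := l)) c \<noteq> 0"
        using p S l by (auto simp: E_def B_def)
      ultimately show ?thesis by blast
    qed
  qed
qed

text \<open>The powers of \<open>x\<close> span an associative subalgebra inside \<open>A\<close>,
  to which \<open>spectral_assoc\<close> applies. \<open>A\<close> serves to locate the idempotents,
  for instance in a Peirce space.\<close>

lemma spectral_decomposition:
  assumes "x \<in> A" "subspace A" "\<And>a b. a \<in> A \<Longrightarrow> b \<in> A \<Longrightarrow> jp a b \<in> A"
  obtains S l where "orthogonal_idempotents S" "S \<subseteq> A" "\<And>c. c \<in> S \<Longrightarrow> l c \<noteq> 0"
    "x = (\<Sum>c\<in>S. l c *\<^sub>R c)"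
proof -
  let ?P = "range (\<lambda>n. (jp x ^^ n) x)"
  have "(jp x ^^ n) x \<in> A" for n
    by (induction n) (use assms in auto)
  then have "span ?P \<subseteq> A" by (intro span_minimal assms(2)) auto
  moreover have "x \<in> span ?P" by (rule span_base) (auto intro: range_eqI[of _ _ 0])
  ultimately show ?thesis
    using spectral_assoc[OF assoc_subalgebra_powers] that by (meson subset_trans)
qed

lemma sum_mult_orthogonal:
  assumes "orthogonal_idempotents S" "d \<in> S"
  shows "jp (\<Sum>c\<in>S. l c *\<^sub>R c) d = l d *\<^sub>R d"
proof -
  have "jp (\<Sum>c\<in>S. l c *\<^sub>R c) d = (\<Sum>c\<in>S. l c *\<^sub>R jp c d)"
    by (simp add: jp.sum_left jp.scaleR_left)
  also have "\<dots> = (\<Sum>c\<in>S. if c = d then l d *\<^sub>R d else 0)"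
    by (rule sum.cong) (use assms in \<open>auto simp: orthogonal_idempotents_def\<close>)
  finally have "jp (\<Sum>c\<in>S. l c *\<^sub>R c) d = (\<Sum>c\<in>S. if c = d then l d *\<^sub>R d else 0)" .
  then show ?thesis using assms by (simp add: orthogonal_idempotents_def)
qed

lemma sum_mult_sum:
  assumes "orthogonal_idempotents S"
  shows "jp (\<Sum>c\<in>S. l c *\<^sub>R c) (\<Sum>c\<in>S. m c *\<^sub>R c) = (\<Sum>c\<in>S. (l c * m c) *\<^sub>R c)"
  using assms
  by (simp add: jp.sum_right jp.scaleR_right sum_mult_orthogonal mult.commute)

lemma nonneg_combination_in_cone:
  assumes "orthogonal_idempotents S" "\<And>c. c \<in> S \<Longrightarrow> 0 \<le> l c"
  shows "(\<Sum>c\<in>S. l c *\<^sub>R c) \<in> cone_of_squares jp"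
proof -
  have "(\<Sum>c\<in>S. l c *\<^sub>R c) = jp (\<Sum>c\<in>S. sqrt (l c) *\<^sub>R c) (\<Sum>c\<in>S. sqrt (l c) *\<^sub>R c)"
    using assms by (simp add: sum_mult_sum)
  then show ?thesis by (auto simp: cone_of_squares_def)
qed

lemma idempotent_in_cone: "jp c c = c \<Longrightarrow> c \<in> cone_of_squares jp"
  by (auto simp: cone_of_squares_def intro!: exI[of _ c])

section \<open>Peirce decomposition\<close>

text \<open>The polynomial 2t^2 - t is 1 at 1 and 0 at 1/2 and 0, the possible eigenvalues of L(c).
  So this is the orthogonal projection onto the eigenspace for 1.\<close>

definition peirce1 :: "'a \<Rightarrow> 'a \<Rightarrow> 'a" where
  "peirce1 c u = 2 *\<^sub>R jp c (jp c u) - jp c u"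

text \<open>This is the linearised identity at \<open>x = y = c\<close>. It says t(2t - 1)(t - 1) =
  0 for \<open>t\<close> = L(c), which confines the eigenvalues to 0, 1/2 and 1.\<close>

lemma idempotent_cubic:
  assumes "jp c c = c"
  shows "2 *\<^sub>R jp c (jp c (jp c u)) = 3 *\<^sub>R jp c (jp c u) - jp c u"
  using linearised_jordan_identity[of c c u] assms scaleR_left_distrib[of 1 2 "jp c (jp c u)"]
  by (simp add: algebra_simps)

lemma peirce1_eigen:
  assumes "jp c c = c"
  shows "jp c (peirce1 c u) = peirce1 c u"
  using idempotent_cubic[OF assms, of u] scaleR_left_distrib[of 1 2 "jp c (jp c u)"]
  by (simp add: peirce1_def jp.diff_right jp.scaleR_right)

text \<open>At \<open>x = c\<close> the linearised identity reads ab = 2ab - c(ab). Thus the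
  eigenspace of L(c) for 1 is a subalgebra.\<close>

lemma peirce1_mult:
  assumes "jp c c = c" "jp c a = a" "jp c b = b"
  shows "jp c (jp a b) = jp a b"
  using linearised_jordan_identity[of c a b] assms by (simp add: algebra_simps scaleR_2)

lemma inner_peirce1:
  assumes "jp c a = a"
  shows "a \<bullet> peirce1 c u = a \<bullet> u"
  using assms inner_jp_commute[of c a]
  by (simp add: peirce1_def inner_diff_right)

text \<open>With \<open>u = u\<^sub>1 + h + k\<close> the decomposition into eigenvectors of \<open>L(c)\<close> for \<open>1, 1/2, 0\<close>, the two
  quadratic forms below are \<open>|u\<^sub>1|\<^sup>2 + |h|\<^sup>2/2\<close> and \<open>|h|\<^sup>2/2 + |k|\<^sup>2\<close>.\<close>

lemma peirce_bounds:
  assumes c: "jp c c = c"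
  shows "0 \<le> jp u u \<bullet> c"
    and "(norm (u - peirce1 c u))\<^sup>2 \<le> 2 * (jp u u \<bullet> (e - c))"
    and "norm (peirce1 c u) \<le> norm u"
proof -
  define u1 where "u1 = peirce1 c u"
  \<comment> \<open>The polynomial 4(t - t^2) is 1 at 1/2 and 0 at 0 and 1.\<close>
  define h where "h = 4 *\<^sub>R (jp c u - jp c (jp c u))"
  define k where "k = u - u1 - h"
  have u: "u = u1 + h + k" by (simp add: k_def)
  have c1: "jp c u1 = u1" using peirce1_eigen[OF c] by (simp add: u1_def)
  have "4 *\<^sub>R jp c (jp c (jp c u)) = 6 *\<^sub>R jp c (jp c u) - 2 *\<^sub>R jp c u"
    using arg_cong[OF idempotent_cubic[OF c, of u], of "scaleR 2"] by (simp add: scaleR_diff_right)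
  then have ch: "jp c h = (1/2) *\<^sub>R h"
    using scaleR_left_distrib[of 4 2 "jp c (jp c u)"]
    by (simp add: h_def jp.diff_right jp.scaleR_right scaleR_diff_right)
  have ck: "jp c k = 0"
    by (simp add: k_def jp.diff_right c1 ch)
       (simp add: u1_def h_def peirce1_def scaleR_diff_right scaleR_2)
  have o: "u1 \<bullet> h = 0" "u1 \<bullet> k = 0" "h \<bullet> k = 0"
    using inner_jp_commute[of c u1 h] inner_jp_commute[of c u1 k] inner_jp_commute[of c h k]
    by (simp_all add: c1 ch ck)
  have "jp u u \<bullet> c = u \<bullet> jp c u"
    by (simp add: inner_associative commutative)
  also have "\<dots> = u1 \<bullet> u1 + (h \<bullet> h) / 2"
    using o by (simp add: u jp.add_right c1 ch ck inner_add_left inner_add_right inner_commute)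
  finally have uc: "jp u u \<bullet> c = u1 \<bullet> u1 + (h \<bullet> h) / 2" .
  have uu: "u \<bullet> u = u1 \<bullet> u1 + h \<bullet> h + k \<bullet> k"
    using o by (simp add: u inner_add_left inner_add_right inner_commute)
  show "0 \<le> jp u u \<bullet> c" by (simp add: uc)
  have "u - peirce1 c u = h + k" by (simp add: k_def u1_def)
  then have "(norm (u - peirce1 c u))\<^sup>2 = h \<bullet> h + k \<bullet> k"
    using o by (simp add: inner_add_left inner_add_right inner_commute power2_norm_eq_inner)
  then show "(norm (u - peirce1 c u))\<^sup>2 \<le> 2 * (jp u u \<bullet> (e - c))"
    by (simp add: inner_diff_right inner_identity uc uu)
  show "norm (peirce1 c u) \<le> norm u"
    by (simp add: u1_def[symmetric] norm_le uu)
qed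

section \<open>Positivity, and faces described by idempotents\<close>

lemma cone_inner_idempotent: "y \<in> cone_of_squares jp \<Longrightarrow> jp c c = c \<Longrightarrow> 0 \<le> y \<bullet> c"
  using peirce_bounds(1) by (auto simp: cone_of_squares_def)

lemma sum_idempotent:
  assumes "orthogonal_idempotents S"
  shows "jp (\<Sum>S) (\<Sum>S) = \<Sum>S"
  using sum_mult_sum[OF assms, of "\<lambda>_. 1" "\<lambda>_. 1"] by simp

lemma subspace_peirce1: "subspace {a. jp c a = a}"
  by (auto simp: subspace_def jp.zero_right jp.add_right jp.scaleR_right)

lemma spectral_peirce1:
  assumes "jp c c = c" "jp c x = x"
  obtains S l where "orthogonal_idempotents S" "\<And>d. d \<in> S \<Longrightarrow> jp c d = d" "\<And>d. d \<in> S \<Longrightarrow> l d \<noteq> 0"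
    "x = (\<Sum>d\<in>S. l d *\<^sub>R d)"
proof (rule spectral_decomposition[of x "{a. jp c a = a}"])
  fix S l
  assume "orthogonal_idempotents S" "S \<subseteq> {a. jp c a = a}" "\<And>d. d \<in> S \<Longrightarrow> l d \<noteq> 0"
    "x = (\<Sum>d\<in>S. l d *\<^sub>R d)"
  then show thesis using that by blast
qed (use assms subspace_peirce1 peirce1_mult[OF assms(1)] in auto)

lemma coefficient_inner:
  assumes "orthogonal_idempotents S" "d \<in> S"
  shows "(\<Sum>c\<in>S. l c *\<^sub>R c) \<bullet> d = l d * (d \<bullet> d)"
proof -
  have "(\<Sum>c\<in>S. l c *\<^sub>R c) \<bullet> d = (\<Sum>c\<in>S. l c *\<^sub>R c) \<bullet> jp d d"
    using assms by (simp add: orthogonal_idempotents_def)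
  also have "\<dots> = jp (\<Sum>c\<in>S. l c *\<^sub>R c) d \<bullet> d" by (simp add: inner_associative)
  finally show ?thesis by (simp add: sum_mult_orthogonal[OF assms])
qed

lemma coefficient_pos:
  assumes "orthogonal_idempotents S" "d \<in> S" "0 \<le> (\<Sum>c\<in>S. l c *\<^sub>R c) \<bullet> d" "l d \<noteq> 0"
  shows "0 < l d"
proof -
  have "d \<bullet> d > 0" using assms(1,2) by (simp add: orthogonal_idempotents_def)
  moreover have "0 \<le> l d * (d \<bullet> d)"
    using assms(3) by (simp only: coefficient_inner[OF assms(1,2)])
  ultimately show ?thesis
    using assms(4) by (metis zero_le_mult_iff not_less order_le_less)
qed

text \<open>Decompose \<open>x\<close> in the eigenspace of \<open>c\<close>. Then
  \<open>q = c - \<Sum>S\<close> is an idempotent orthogonal to \<open>S\<close>, and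
  \<open>t *\<^sub>R c - x\<close> combines \<open>q\<close> and \<open>S\<close> with nonnegative
  coefficients once \<open>t\<close> exceeds all eigenvalues.\<close>

lemma cone_le_idempotent:
  assumes c: "jp c c = c" and x: "x \<in> cone_of_squares jp" "jp c x = x"
  shows "\<exists>t>0. t *\<^sub>R c - x \<in> cone_of_squares jp"
proof -
  obtain S l where S: "orthogonal_idempotents S" "\<And>d. d \<in> S \<Longrightarrow> jp c d = d"
    and l: "\<And>d. d \<in> S \<Longrightarrow> l d \<noteq> 0" and xS: "x = (\<Sum>d\<in>S. l d *\<^sub>R d)"
    using spectral_peirce1[OF c x(2)] by blast
  have fin: "finite S" using S by (simp add: orthogonal_idempotents_def)
  have pos: "0 < l d" if "d \<in> S" for d
    using coefficient_pos[OF S(1) that] cone_inner_idempotent[OF x(1)] that S(1) l[OF that]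
    by (simp add: xS orthogonal_idempotents_def)
  \<comment> \<open>The summand 1 keeps \<open>t\<close> positive when \<open>S\<close> is
    empty.\<close>
  define t where "t = 1 + (\<Sum>d\<in>S. l d)"
  have t: "l d \<le> t" if "d \<in> S" for d
    using member_le_sum[of d S l] that pos fin by (fastforce simp: t_def less_imp_le)
  have t0: "t > 0" using pos sum_nonneg[of S l] by (simp add: t_def less_imp_le add_pos_nonneg)
  define q where "q = c - \<Sum>S"
  define s where "s = (\<Sum>d\<in>S. sqrt (t - l d) *\<^sub>R d)"
  have cS: "jp c (\<Sum>S) = \<Sum>S" using S(2) by (simp add: jp.sum_right)
  have qd: "jp q d = 0" if "d \<in> S" for d
    using sum_mult_orthogonal[OF S(1) that, of "\<lambda>_. 1"] S(2)[OF that] by (simp add: q_def jp.diff_left)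
  have qq: "jp q q = q"
    using sum_idempotent[OF S(1)] cS c
    by (simp add: q_def jp.diff_left jp.diff_right commutative[of "\<Sum>S" c])
  have qs: "jp q s = 0" using qd by (simp add: s_def jp.sum_right jp.scaleR_right)
  have ss: "jp s s = (\<Sum>d\<in>S. (t - l d) *\<^sub>R d)"
    using t by (simp add: s_def sum_mult_sum[OF S(1)])
  \<comment> \<open>The square root is written out since \<open>q\<close> may be 0, which
    \<open>orthogonal_idempotents\<close> excludes.\<close>
  have "jp (sqrt t *\<^sub>R q + s) (sqrt t *\<^sub>R q + s) = t *\<^sub>R q + (\<Sum>d\<in>S. (t - l d) *\<^sub>R d)"
    using t0 by (simp add: jp.add_left jp.add_right jp.scaleR_left jp.scaleR_right qq qs ss
        commutative[of s q])
  also have "\<dots> = t *\<^sub>R c - x"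
    by (simp add: q_def xS scaleR_diff_right scaleR_diff_left sum_subtractf scaleR_sum_right)
  finally have "t *\<^sub>R c - x \<in> cone_of_squares jp"
    unfolding cone_of_squares_def by (metis (mono_tags, lifting) mem_Collect_eq)
  with t0 show ?thesis by blast
qed

text \<open>A multiple of \<open>c\<close> in \<open>F\<close> is the sum of \<open>x\<close> and
  another square, so the face property applies. This lets membership in a face be checked by one
  linear equation.\<close>

lemma cone_face_contains:
  assumes F: "cone_face F (cone_of_squares jp)" and c: "jp c c = c" "c \<in> F"
    and x: "x \<in> cone_of_squares jp" "jp c x = x"
  shows "x \<in> F"
proof -
  obtain t where t: "t > 0" "t *\<^sub>R c - x \<in> cone_of_squares jp"
    using cone_le_idempotent[OF c(1) x] by blast
  have "t *\<^sub>R c \<in> F" using F c t by (auto simp: cone_face_def convex_cone_def conic_def)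
  then have "t *\<^sub>R c - x + x \<in> F" by simp
  with F t x show ?thesis unfolding cone_face_def by blast
qed

text \<open>The idempotent is the support of a relative interior point of the face.\<close>

lemma cone_face_idempotent:
  assumes F: "cone_face F (cone_of_squares jp)"
  obtains c where "jp c c = c" "c \<in> F" "\<And>y. y \<in> F \<Longrightarrow> jp c y = y"
proof -
  have cc: "convex F" "F \<noteq> {}" and cone: "\<And>t y. y \<in> F \<Longrightarrow> 0 \<le> t \<Longrightarrow> t *\<^sub>R y \<in> F"
    and sub: "F \<subseteq> cone_of_squares jp"
    and face: "\<And>y w. y \<in> cone_of_squares jp \<Longrightarrow> w \<in> cone_of_squares jp \<Longrightarrow> y + w \<in> F \<Longrightarrow> w \<in> F"
    using F by (auto simp: cone_face_def convex_cone_def conic_def)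
  obtain x where x: "x \<in> rel_interior F"
    using cc rel_interior_eq_empty by blast
  then have xF: "x \<in> F" using rel_interior_subset by blast
  obtain S l where S: "orthogonal_idempotents S" and l: "\<And>d. d \<in> S \<Longrightarrow> l d \<noteq> 0"
    and xS: "x = (\<Sum>d\<in>S. l d *\<^sub>R d)"
    using spectral_decomposition[of x UNIV] by auto
  have fin: "finite S" using S by (simp add: orthogonal_idempotents_def)
  have pos: "0 < l d" if "d \<in> S" for d
    using coefficient_pos[OF S that] cone_inner_idempotent[of x d] that S l[OF that] xF sub
    by (auto simp: xS orthogonal_idempotents_def)
  define c where "c = \<Sum>S"
  have c: "jp c c = c" using sum_idempotent[OF S] by (simp add: c_def)
  \<comment> \<open>Large enough for \<open>t *\<^sub>R x - c\<close> to have nonnegative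
    coefficients; then \<open>c\<close> is a summand of a point of \<open>F\<close>.\<close>
  define t where "t = (\<Sum>d\<in>S. 1 / l d)"
  have t: "1 \<le> t * l d" if "d \<in> S" for d
  proof -
    have "1 / l d \<le> t" unfolding t_def
      using member_le_sum[of d S "\<lambda>d. 1 / l d"] that pos fin by (simp add: less_imp_le)
    then show ?thesis using pos[OF that] by (simp add: divide_simps)
  qed
  have "t *\<^sub>R x - c = (\<Sum>d\<in>S. (t * l d - 1) *\<^sub>R d)"
    by (simp add: xS c_def scaleR_sum_right scaleR_diff_left sum_subtractf)
  then have "t *\<^sub>R x - c \<in> cone_of_squares jp"
    using nonneg_combination_in_cone[OF S, of "\<lambda>d. t * l d - 1"] t by simp
  moreover have "t *\<^sub>R x \<in> F" using cone[OF xF] pos by (simp add: t_def sum_nonneg less_imp_le)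
  ultimately have cF: "c \<in> F"
    using face[of "t *\<^sub>R x - c" c] idempotent_in_cone[OF c] by simp
  have "jp c y = y" if y: "y \<in> F" for y
  proof -
    \<comment> \<open>The segment from \<open>y\<close> to \<open>x\<close> extends beyond
      \<open>x\<close> within \<open>F\<close>. As \<open>x\<close> is orthogonal to
      \<open>e - c\<close>, a positive \<open>y \<bullet> (e - c)\<close> would become negative at
      the extension.\<close>
    obtain s where s: "s > 1" "(1 - s) *\<^sub>R y + s *\<^sub>R x \<in> F"
      using x convex_rel_interior_iff[OF cc] y by blast
    have ec: "jp (e - c) (e - c) = e - c"
      by (simp add: jp.diff_left jp.diff_right c identity identity_right)
    have "jp x c = x"
      using sum_mult_sum[OF S, of l "\<lambda>_. 1"] by (simp add: c_def xS)
    then have "x \<bullet> (e - c) = 0"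
      using inner_identity[of x c] by (simp add: inner_diff_right)
    moreover have "0 \<le> ((1 - s) *\<^sub>R y + s *\<^sub>R x) \<bullet> (e - c)"
      using cone_inner_idempotent[OF _ ec] s sub by blast
    ultimately have "y \<bullet> (e - c) \<le> 0"
      using s(1) by (simp add: inner_add_left zero_le_mult_iff)
    moreover obtain u where u: "y = jp u u"
      using y sub by (auto simp: cone_of_squares_def)
    ultimately have "jp u u \<bullet> (e - c) \<le> 0" by simp
    with peirce_bounds(2)[OF c, of u] have "(norm (u - peirce1 c u))\<^sup>2 \<le> 0" by linarith
    then have "jp c u = u" using peirce1_eigen[OF c, of u] by simp
    then show ?thesis using peirce1_mult[OF c] u by simp
  qed
  with c cF that show ?thesis by blast
qed

text \<open>On \<open>F\<close> the functional \<open>z\<close> is nonnegative, so it vanishes on a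
  sum only if it vanishes on both summands.\<close>

lemma cone_face_orthogonal:
  assumes "cone_face F K" "z \<in> dual_cone F"
  shows "cone_face (F \<inter> {z}\<^sup>\<bottom>) K"
proof -
  have "convex_cone (F \<inter> {z}\<^sup>\<bottom>)"
    using assms(1) convex_cone_Inter[of "{F, {z}\<^sup>\<bottom>}"]
      subspace_imp_convex_cone[OF subspace_orthogonal_comp[of "{z}"]]
    by (fastforce simp: cone_face_def)
  moreover have "x \<in> {z}\<^sup>\<bottom> \<and> y \<in> {z}\<^sup>\<bottom>" if "x \<in> F" "y \<in> F" "x + y \<in> {z}\<^sup>\<bottom>" for x y
  proof -
    have "0 \<le> z \<bullet> x" "0 \<le> z \<bullet> y" "z \<bullet> x + z \<bullet> y = 0"
      using that assms(2) by (auto simp: dual_cone_def orthogonal_comp_def orthogonal_def inner_add_right)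
    then show ?thesis by (simp add: orthogonal_comp_def orthogonal_def)
  qed
  ultimately show ?thesis using assms(1) unfolding cone_face_def by blast
qed

text \<open>Write \<open>z = \<Sum> l\<^sub>d d + z'\<close> with \<open>z'\<close> orthogonal to the eigenspace of \<open>c\<close> for \<open>1\<close>. The
  \<open>l\<^sub>d\<close> are positive because the idempotents \<open>d\<close> lie in \<open>F\<close>, and removing them from \<open>c\<close>
  leaves the idempotent \<open>g\<close>.\<close>

lemma exposed_face_idempotent:
  assumes F: "cone_face F (cone_of_squares jp)" and c: "jp c c = c" "c \<in> F"
    and z: "z \<in> dual_cone F"
  obtains g m where "jp g g = g" "g \<in> F \<inter> {z}\<^sup>\<bottom>" "0 \<le> m"
    "\<And>y. y \<in> cone_of_squares jp \<Longrightarrow> y \<bullet> (c - g) \<le> m * (y \<bullet> peirce1 c z)"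
proof -
  obtain S l where S: "orthogonal_idempotents S" and cS: "\<And>d. d \<in> S \<Longrightarrow> jp c d = d"
    and l: "\<And>d. d \<in> S \<Longrightarrow> l d \<noteq> 0" and zS: "peirce1 c z = (\<Sum>d\<in>S. l d *\<^sub>R d)"
    using spectral_peirce1[OF c(1) peirce1_eigen[OF c(1)]] by blast
  have fin: "finite S" and idem: "\<And>d. d \<in> S \<Longrightarrow> jp d d = d"
    using S by (auto simp: orthogonal_idempotents_def)
  have pos: "0 < l d" if d: "d \<in> S" for d
  proof (rule coefficient_pos[OF S d, of l])
    have "d \<in> F" using cone_face_contains[OF F c] idempotent_in_cone idem[OF d] cS[OF d] by blast
    then have "0 \<le> d \<bullet> peirce1 c z"
      using z by (simp add: inner_peirce1[OF cS[OF d]] dual_cone_def inner_commute)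
    then show "0 \<le> (\<Sum>c\<in>S. l c *\<^sub>R c) \<bullet> d" by (simp add: zS inner_commute)
  qed (rule l[OF d])
  define g where "g = c - \<Sum>S"
  have cg: "jp c (\<Sum>S) = \<Sum>S" using cS by (simp add: jp.sum_right)
  then have c_g: "jp c g = g" by (simp add: g_def jp.diff_right c)
  have gg: "jp g g = g"
    using cg c sum_idempotent[OF S]
    by (simp add: g_def jp.diff_right jp.diff_left commutative[of "\<Sum>S" c])
  have gd: "g \<bullet> d = 0" if "d \<in> S" for d
  proof -
    have "jp g d = 0"
      using sum_mult_orthogonal[OF S that, of "\<lambda>_. 1"] cS[OF that] by (simp add: g_def jp.diff_left)
    then show ?thesis using inner_identity[of g d] by simp
  qed
  have "g \<in> F"
    using cone_face_contains[OF F c idempotent_in_cone[OF gg] c_g] .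
  moreover have "g \<bullet> z = 0"
    using inner_peirce1[OF c_g, of z] gd by (simp add: zS inner_sum_right)
  ultimately have gF: "g \<in> F \<inter> {z}\<^sup>\<bottom>"
    by (simp add: orthogonal_comp_def orthogonal_def inner_commute)
  define m where "m = (\<Sum>d\<in>S. 1 / l d)"
  have m: "1 \<le> m * l d" if "d \<in> S" for d
  proof -
    have "1 / l d \<le> m" unfolding m_def
      using member_le_sum[of d S "\<lambda>d. 1 / l d"] that pos fin by (simp add: less_imp_le)
    then show ?thesis using pos[OF that] by (simp add: divide_simps)
  qed
  have "y \<bullet> (c - g) \<le> m * (y \<bullet> peirce1 c z)" if y: "y \<in> cone_of_squares jp" for y
  proof -
    have "y \<bullet> (c - g) = (\<Sum>d\<in>S. 1 * (y \<bullet> d))" by (simp add: g_def inner_sum_right)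
    also have "\<dots> \<le> (\<Sum>d\<in>S. (m * l d) * (y \<bullet> d))"
      using m cone_inner_idempotent[OF y] idem by (intro sum_mono mult_right_mono) auto
    also have "\<dots> = m * (y \<bullet> peirce1 c z)"
      by (simp add: zS inner_sum_right sum_distrib_left mult.assoc)
    finally show ?thesis .
  qed
  moreover have "0 \<le> m" using pos by (simp add: m_def sum_nonneg less_imp_le)
  ultimately show ?thesis using that gg gF by blast
qed

text \<open>For \<open>y = u\<^sup>2\<close> take \<open>w = u\<^sub>1\<^sup>2\<close>, where \<open>u\<^sub>1\<close> is the Peirce component of \<open>u\<close>; then
  \<open>y - w = (u - u\<^sub>1)(u + u\<^sub>1)\<close>.\<close>

lemma cone_peirce1_approximation:
  obtains M where "0 < M"
    "\<And>c y. jp c c = c \<Longrightarrow> y \<in> cone_of_squares jp \<Longrightarrow>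
       \<exists>w\<in>cone_of_squares jp. jp c w = w \<and> (norm (y - w))\<^sup>2 \<le> M * (y \<bullet> (e - c)) * (y \<bullet> e)"
proof -
  obtain B where B: "B > 0" "\<And>a b. norm (jp a b) \<le> norm a * norm b * B"
    using jp.pos_bounded by blast
  show ?thesis
  \<comment> \<open>The 8 is 2 from the Peirce bound times the square of 2 from
    \<open>norm (u + u1) \<le> 2 * norm u\<close>.\<close>
  proof (rule that[of "8 * B\<^sup>2"])
    fix c y assume c: "jp c c = c" and "y \<in> cone_of_squares jp"
    then obtain u where y: "y = jp u u" by (auto simp: cone_of_squares_def)
    define u1 where "u1 = peirce1 c u"
    note bounds = peirce_bounds(2,3)[OF c, of u, folded u1_def y]
    have "norm (u + u1) \<le> 2 * norm u"
      using norm_triangle_ineq[of u u1] bounds(2) by simp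
    moreover have "y - jp u1 u1 = jp (u - u1) (u + u1)"
      by (simp add: y jp.diff_left jp.add_right commutative[of u1 u])
    ultimately have "norm (y - jp u1 u1) \<le> norm (u - u1) * (2 * norm u) * B"
      using B(2)[of "u - u1" "u + u1"] B(1)
      by (smt (verit) mult_left_mono mult_right_mono norm_ge_zero)
    then have "(norm (y - jp u1 u1))\<^sup>2 \<le> (norm (u - u1) * (2 * norm u) * B)\<^sup>2"
      by (rule power_mono) simp
    also have "\<dots> = (norm (u - u1))\<^sup>2 * (4 * B\<^sup>2 * (norm u)\<^sup>2)"
      by (simp add: power_mult_distrib)
    also have "\<dots> \<le> (2 * (y \<bullet> (e - c))) * (4 * B\<^sup>2 * (norm u)\<^sup>2)"
      using bounds(1) by (rule mult_right_mono) simp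
    also have "\<dots> = 8 * B\<^sup>2 * (y \<bullet> (e - c)) * (y \<bullet> e)"
      by (simp add: y inner_identity power2_norm_eq_inner)
    finally have "(norm (y - jp u1 u1))\<^sup>2 \<le> 8 * B\<^sup>2 * (y \<bullet> (e - c)) * (y \<bullet> e)" .
    moreover have "jp c (jp u1 u1) = jp u1 u1"
      using peirce1_mult[OF c] peirce1_eigen[OF c] by (simp add: u1_def)
    ultimately show "\<exists>w\<in>cone_of_squares jp. jp c w = w \<and>
        (norm (y - w))\<^sup>2 \<le> 8 * B\<^sup>2 * (y \<bullet> (e - c)) * (y \<bullet> e)"
      by (auto simp: cone_of_squares_def)
  qed (use B in simp)
qed

section \<open>The residual estimate for a face\<close>

lemma face_error_bound:
  assumes F: "cone_face F (cone_of_squares jp)" and z: "z \<in> dual_cone F"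
  obtains \<kappa> where "\<kappa> > 0"
    "\<And>x \<epsilon>. infdist x (cone_of_squares jp) \<le> \<epsilon> \<Longrightarrow> x \<bullet> z \<le> \<epsilon> \<Longrightarrow> infdist x (span F) \<le> \<epsilon> \<Longrightarrow>
       infdist x (F \<inter> {z}\<^sup>\<bottom>) \<le> \<kappa> * \<epsilon> + \<kappa> * sqrt (\<epsilon> * norm x)"
proof -
  obtain c where c: "jp c c = c" "c \<in> F" and Fc: "\<And>y. y \<in> F \<Longrightarrow> jp c y = y"
    using cone_face_idempotent[OF F] by blast
  obtain g m where g: "jp g g = g" "g \<in> F \<inter> {z}\<^sup>\<bottom>" and m: "0 \<le> m"
    and cg: "\<And>y. y \<in> cone_of_squares jp \<Longrightarrow> y \<bullet> (c - g) \<le> m * (y \<bullet> peirce1 c z)"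
    using exposed_face_idempotent[OF F c z] by blast
  obtain M where M: "0 < M" and approx: "\<And>c y. jp c c = c \<Longrightarrow> y \<in> cone_of_squares jp \<Longrightarrow>
       \<exists>w\<in>cone_of_squares jp. jp c w = w \<and> (norm (y - w))\<^sup>2 \<le> M * (y \<bullet> (e - c)) * (y \<bullet> e)"
    using cone_peirce1_approximation by blast
  have spanc: "jp c s = s" if "s \<in> span F" for s
    using span_minimal[OF _ subspace_peirce1[of c], of F] Fc that by blast
  \<comment> \<open>\<open>C\<close> is the constant in
    \<open>y \<bullet> (e - g) \<le> C * \<eta>\<close>; \<open>D\<close> adds the factors from the
    approximation in the smaller face and from \<open>y \<bullet> e\<close>.\<close>
  define C where "C = 2 * norm (e - c) + m * (2 * norm (peirce1 c z) + norm z + 1)"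
  define D where "D = sqrt (M * C * norm e)"
  have C: "0 \<le> C" using m by (simp add: C_def)
  have D: "0 \<le> D" using C M by (simp add: D_def)
  \<comment> \<open>With strict inequalities, points within \<eta> of \<open>x\<close> exist without
    any closedness; afterwards \<eta> decreases to \<epsilon>.\<close>
  have bound: "infdist x (F \<inter> {z}\<^sup>\<bottom>) \<le> (1 + D) * \<eta> + D * sqrt (\<eta> * norm x)"
    if x: "infdist x (cone_of_squares jp) < \<eta>" "x \<bullet> z < \<eta>" "infdist x (span F) < \<eta>" for x \<eta>
  proof -
    have ne: "cone_of_squares jp \<noteq> {}" "span F \<noteq> {}"
      using span_zero[of F] by (auto simp: cone_of_squares_def)
    have \<eta>: "\<eta> > 0" using x(1) infdist_nonneg[of x "cone_of_squares jp"] by linarith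
    obtain y where y: "y \<in> cone_of_squares jp" "dist x y < \<eta>"
      using infdist_less_obtain[OF x(1) ne(1)] .
    obtain s where s: "s \<in> span F" "dist x s < \<eta>"
      using infdist_less_obtain[OF x(3) ne(2)] .
    have ys: "norm (y - s) \<le> 2 * \<eta>"
      using dist_triangle[of y s x] y(2) s(2) by (simp add: dist_norm[of y s] dist_commute[of y x])
    have near: "(y - s) \<bullet> a \<le> 2 * \<eta> * norm a" for a
      using norm_cauchy_schwarz[of "y - s" a] mult_right_mono[OF ys norm_ge_zero[of a]] by linarith
    have "s \<bullet> (e - c) = 0"
      using inner_identity[of s c] spanc[OF s(1)] by (simp add: inner_diff_right commutative[of s c])
    then have 1: "y \<bullet> (e - c) \<le> 2 * \<eta> * norm (e - c)"
      using near[of "e - c"] by (simp add: inner_diff_left)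
    have "(s - x) \<bullet> z \<le> \<eta> * norm z"
      using norm_cauchy_schwarz[of "s - x" z] mult_right_mono[OF less_imp_le[OF s(2)] norm_ge_zero[of z]]
      by (simp add: dist_norm norm_minus_commute)
    \<comment> \<open>On \<open>span F\<close> the projection \<open>peirce1 c z\<close> has the
      same inner products as \<open>z\<close>, so the hypothesis on \<open>x \<bullet> z\<close>
      carries over to \<open>s\<close>.\<close>
    then have "s \<bullet> peirce1 c z \<le> \<eta> * norm z + \<eta>"
      using x(2) by (simp add: inner_peirce1[OF spanc[OF s(1)]] inner_diff_left)
    then have 2: "y \<bullet> peirce1 c z \<le> \<eta> * (2 * norm (peirce1 c z) + norm z + 1)"
      using near[of "peirce1 c z"] by (simp add: inner_diff_left algebra_simps)
    have "y \<bullet> (e - g) = y \<bullet> (e - c) + y \<bullet> (c - g)" by (simp add: inner_diff_right)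
    also have "\<dots> \<le> 2 * \<eta> * norm (e - c) + m * (\<eta> * (2 * norm (peirce1 c z) + norm z + 1))"
      using 1 cg[OF y(1)] mult_left_mono[OF 2 m] by linarith
    also have "\<dots> = C * \<eta>" by (simp add: C_def algebra_simps)
    finally have yg: "y \<bullet> (e - g) \<le> C * \<eta>" .
    have "norm y \<le> norm x + \<eta>"
      using norm_triangle_ineq2[of y x] y(2) by (simp add: dist_norm norm_minus_commute)
    then have ye: "y \<bullet> e \<le> (norm x + \<eta>) * norm e"
      using norm_cauchy_schwarz[of y e] mult_right_mono[OF _ norm_ge_zero[of e]] order_trans by blast
    obtain w where w: "w \<in> cone_of_squares jp" "jp g w = w"
      and yw: "(norm (y - w))\<^sup>2 \<le> M * (y \<bullet> (e - g)) * (y \<bullet> e)"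
      using approx[OF g(1) y(1)] by blast
    have wF: "w \<in> F \<inter> {z}\<^sup>\<bottom>"
      using cone_face_contains[OF cone_face_orthogonal[OF F z] g w] .
    have "(y \<bullet> (e - g)) * (y \<bullet> e) \<le> (C * \<eta>) * ((norm x + \<eta>) * norm e)"
      using yg ye C \<eta> cone_inner_idempotent[OF y(1) identity] by (intro mult_mono) auto
    then have "M * ((y \<bullet> (e - g)) * (y \<bullet> e)) \<le> M * ((C * \<eta>) * ((norm x + \<eta>) * norm e))"
      using M by simp
    also have "\<dots> = D\<^sup>2 * (\<eta> * norm x + \<eta>\<^sup>2)"
      using C M by (simp add: D_def algebra_simps power2_eq_square)
    \<comment> \<open>Expanding the square on the right adds only a nonnegative cross term.\<close>
    also have "\<dots> \<le> (D * (sqrt (\<eta> * norm x) + \<eta>))\<^sup>2"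
      using \<eta> by (simp add: power_mult_distrib power2_sum mult_left_mono)
    finally have "(norm (y - w))\<^sup>2 \<le> (D * (sqrt (\<eta> * norm x) + \<eta>))\<^sup>2"
      using yw by (simp only: mult.assoc)
    then have "norm (y - w) \<le> D * (sqrt (\<eta> * norm x) + \<eta>)"
      by (rule power2_le_imp_le) (use D \<eta> x in \<open>auto intro!: mult_nonneg_nonneg add_nonneg_nonneg\<close>)
    moreover have "infdist x (F \<inter> {z}\<^sup>\<bottom>) \<le> dist x y + norm (y - w)"
      using infdist_le[OF wF, of x] dist_triangle[of x w y] by (simp add: dist_norm[of y w])
    ultimately show ?thesis using y(2) by (simp add: algebra_simps)
  qed
  show ?thesis
  proof (rule that[of "1 + D"])
    fix x \<epsilon>
    assume x: "infdist x (cone_of_squares jp) \<le> \<epsilon>" "x \<bullet> z \<le> \<epsilon>" "infdist x (span F) \<le> \<epsilon>"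
    have "infdist x (F \<inter> {z}\<^sup>\<bottom>) \<le> (1 + D) * \<epsilon> + D * sqrt (\<epsilon> * norm x)"
    proof (rule tendsto_lowerbound)
      show "((\<lambda>\<eta>. (1 + D) * \<eta> + D * sqrt (\<eta> * norm x)) \<longlongrightarrow>
          (1 + D) * \<epsilon> + D * sqrt (\<epsilon> * norm x)) (at_right \<epsilon>)"
        by (intro tendsto_intros)
      show "\<forall>\<^sub>F \<eta> in at_right \<epsilon>. infdist x (F \<inter> {z}\<^sup>\<bottom>) \<le> (1 + D) * \<eta> + D * sqrt (\<eta> * norm x)"
        using x bound by (intro eventually_at_rightI[of \<epsilon> "\<epsilon> + 1"]) auto
    qed simp
    moreover have "0 \<le> sqrt (\<epsilon> * norm x)"
      using x(1) infdist_nonneg[of x "cone_of_squares jp"] by simp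
    ultimately show "infdist x (F \<inter> {z}\<^sup>\<bottom>) \<le> (1 + D) * \<epsilon> + (1 + D) * sqrt (\<epsilon> * norm x)"
      unfolding distrib_right by linarith
  qed (use D in simp)
qed

end

theorem theorem35:
  fixes jp :: "'a::euclidean_space \<Rightarrow> 'a \<Rightarrow> 'a" and e :: 'a
    and K F :: "'a set" and z :: 'a
  assumes "euclidean_jordan_algebra jp e"
    and "\<And>x y. x \<bullet> y = jordan_trace jp e (jp x y)"
    and "K = cone_of_squares jp"
    and "cone_face F K"
    and "z \<in> dual_cone F"
  shows "\<exists>\<kappa>>0.
    (\<forall>x \<epsilon>. infdist x K \<le> \<epsilon> \<and> x \<bullet> z \<le> \<epsilon> \<and> infdist x (span F) \<le> \<epsilon> \<longrightarrow>
       infdist x (F \<inter> {z}\<^sup>\<bottom>) \<le> \<kappa> * \<epsilon> + \<kappa> * sqrt (\<epsilon> * norm x)) \<and>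
    facial_residual_function K F z (\<lambda>\<epsilon> t. \<kappa> * \<epsilon> + \<kappa> * sqrt (\<epsilon> * t))"
proof -
  interpret euclidean_jordan_algebra jp e by fact
  obtain \<kappa> where \<kappa>: "\<kappa> > 0"
    and bound: "\<And>x \<epsilon>. infdist x K \<le> \<epsilon> \<Longrightarrow> x \<bullet> z \<le> \<epsilon> \<Longrightarrow> infdist x (span F) \<le> \<epsilon> \<Longrightarrow>
       infdist x (F \<inter> {z}\<^sup>\<bottom>) \<le> \<kappa> * \<epsilon> + \<kappa> * sqrt (\<epsilon> * norm x)"
    using face_error_bound[OF assms(4)[unfolded assms(3)] assms(5)] unfolding assms(3) by blast
  have "facial_residual_function K F z (\<lambda>\<epsilon> t. \<kappa> * \<epsilon> + \<kappa> * sqrt (\<epsilon> * t))"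
    unfolding facial_residual_function_def
  proof (intro conjI allI impI ballI)
    fix a a' b :: real assume "0 \<le> a \<and> a \<le> a' \<and> 0 \<le> b"
    then show "\<kappa> * a + \<kappa> * sqrt (a * b) \<le> \<kappa> * a' + \<kappa> * sqrt (a' * b)"
      using \<kappa> by (intro add_mono mult_left_mono real_sqrt_le_mono mult_right_mono) auto
  next
    fix a b b' :: real assume "0 \<le> a \<and> 0 \<le> b \<and> b \<le> b'"
    then show "\<kappa> * a + \<kappa> * sqrt (a * b) \<le> \<kappa> * a + \<kappa> * sqrt (a * b')"
      using \<kappa> by (intro add_mono mult_left_mono real_sqrt_le_mono) auto
  qed (use \<kappa> bound in auto)
  with \<kappa> bound show ?thesis by blast
qed

end
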